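(* Let $n\ge 1$ and let $A'$ be the set of the encodings of all Sperner families of size two on $[n]=\{1,\dots,n\}$. Then there exists a universal cycle for $A'$.
   Context: A Sperner family of size two on $[n]$ is an ordered pair $(A_1,A_2)\in 2^{[n]}\times 2^{[n]}$ such that $A_1\not\subseteq A_2$ and $A_2\not\subseteq A_1$. Let $s_1,s_2\in\{0,1\}^n$ be the indicator strings of $A_1,A_2$. The pair is encoded by the word $s=s_1\odot s_2$ of length $n$ over $\{0,1,2,3\}$, where $s[i]=0,1,2,3$ according as $s_1[i]s_2[i]$ is $00,01,10,11$. A universal cycle for a finite set $A'$ of words of length $n$ over a finite alphabet is a cyclic sequence $c_0c_1\cdots c_{L-1}$ of letters, with $L=|A'|$, such that every word of $A'$ occurs exactly once among the $L$ windows $c_ic_{i+1}\cdots c_{i+n-1}$, $0\le i<L$ (indices modulo $L$). (If $A'$ is empty, the empty sequence is a universal cycle.) *)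

theory Defs
  imports Main
begin

definition sperner_pair :: "nat \<Rightarrow> nat set \<times> nat set \<Rightarrow> bool" where
  "sperner_pair n P \<longleftrightarrow>
     fst P \<subseteq> {1..n} \<and> snd P \<subseteq> {1..n} \<and>
     \<not> fst P \<subseteq> snd P \<and> \<not> snd P \<subseteq> fst P"

definition indicator_string :: "nat \<Rightarrow> nat set \<Rightarrow> nat list" where
  "indicator_string n A = map (\<lambda>i. if i \<in> A then 1 else 0) [1..<Suc n]"

(* On letters 0 and 1, the value 2 * a + b sends the pairs 00, 01, 10, 11 to 0, 1, 2, 3. *)
definition string_odot :: "nat list \<Rightarrow> nat list \<Rightarrow> nat list" (infixl "\<odot>" 70) where
  "s \<odot> t = map2 (\<lambda>a b. 2 * a + b) s t"

definition sperner_encodings :: "nat \<Rightarrow> nat list set" where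
  "sperner_encodings n =
     {indicator_string n A\<^sub>1 \<odot> indicator_string n A\<^sub>2 | A\<^sub>1 A\<^sub>2. sperner_pair n (A\<^sub>1, A\<^sub>2)}"

definition cyclic_window :: "nat \<Rightarrow> 'a list \<Rightarrow> nat \<Rightarrow> 'a list" where
  "cyclic_window n c i = map (\<lambda>j. c ! ((i + j) mod length c)) [0..<n]"

(* The cyclic sequence is represented by a list c starting at an arbitrary position. It may be
   shorter than n, in which case a window wraps around more than once. For empty c there are
   no indices i < length c, so [] is a universal cycle exactly for the empty set of words. *)
definition universal_cycle :: "'a set \<Rightarrow> nat \<Rightarrow> 'a list set \<Rightarrow> 'a list \<Rightarrow> bool" where
  "universal_cycle \<Sigma> n W c \<longleftrightarrow>
     finite \<Sigma> \<and> finite W \<and> (\<forall>w \<in> W. length w = n \<and> set w \<subseteq> \<Sigma>) \<and>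
     set c \<subseteq> \<Sigma> \<and> length c = card W \<and>
     (\<forall>w \<in> W. \<exists>!i. i < length c \<and> cyclic_window n c i = w)"

end

theory Submission
  imports Defs "Graph_Theory.Euler"
begin

text \<open>
  Encoded in letters, \<open>A\<^sub>1 \<not>\<subseteq> A\<^sub>2\<close> says that the letter 2 occurs and \<open>A\<^sub>2 \<not>\<subseteq> A\<^sub>1\<close> that the
  letter 1 occurs. So the encodings of Sperner pairs are exactly the words of length \<open>n\<close> over
  \<open>{0, 1, 2, 3}\<close> that contain both 1 and 2 (lemma \<open>sperner_encodings_eq\<close>).

  For a finite nonempty set \<open>W\<close> of words of length \<open>n\<close>, a universal cycle is a closed Euler trail in the digraph
  whose arcs are the words of \<open>W\<close>, each running from its prefix of length \<open>n - 1\<close> to its suffix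
  of length \<open>n - 1\<close>: consecutive windows of a cyclic sequence overlap in \<open>n - 1\<close> letters, and
  conversely the first letters of the arcs of the trail spell the sequence. If \<open>W\<close> is closed under
  rotation, the digraph is balanced, because rotation by one place maps the arcs that enter a
  vertex bijectively to the arcs that leave it. By Euler's theorem only connectedness remains
  (theorem \<open>universal_cycle_if_rotation_closed\<close>).

  In a rotation-closed set, changing one letter of a word without leaving the set stays inside a
  component: rotate that letter to the front, shift it out while shifting the new letter in, and
  go on rotating (lemma \<open>linked_list_update\<close>). Containing 1 and 2 does not depend on the order of
  letters, and from any word with both letters one gets by a rotation and a single change of a
  letter to a word that begins with 1, 2. Behind this prefix all letters can be changed freely, so
  all the words are in one component.
\<close>

section \<open>Universal cycles from Euler trails\<close>

definition overlap :: "'a list set \<Rightarrow> ('a list \<times> 'a list) set" where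
  "overlap W = {(u, v). u \<in> W \<and> v \<in> W \<and> tl u = butlast v}"

text \<open>
  In a balanced digraph weak connectedness is enough for Euler's theorem, and the symmetric
  closure makes every connection between words reversible at no cost.
\<close>
definition linked :: "'a list set \<Rightarrow> ('a list \<times> 'a list) set" where
  "linked W = (overlap W \<union> (overlap W)\<inverse>)\<^sup>*"

lemma linked_refl: "(u, u) \<in> linked W"
  by (simp add: linked_def)

lemma linked_sym: "(u, v) \<in> linked W \<Longrightarrow> (v, u) \<in> linked W"
  unfolding linked_def by (meson sym_Un_converse sym_rtrancl symD)

lemma linked_trans: "(u, v) \<in> linked W \<Longrightarrow> (v, w) \<in> linked W \<Longrightarrow> (u, w) \<in> linked W"
  unfolding linked_def by (rule rtrancl_trans)

lemma linked_overlap: "(u, v) \<in> overlap W \<Longrightarrow> (u, v) \<in> linked W"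
  by (auto simp: linked_def)

definition overlap_digraph :: "'a list set \<Rightarrow> ('a list, 'a list) pre_digraph" where
  "overlap_digraph W = \<lparr>verts = tl ` W, arcs = W, tail = butlast, head = tl\<rparr>"

lemma arcs_overlap_digraph: "arcs (overlap_digraph W) = W"
  by (simp add: overlap_digraph_def)

lemma butlast_rotate1: "butlast (rotate1 w) = tl w"
  by (cases w) auto

text \<open>
  A rotation-closed set is mapped into itself by the injective function \<^const>\<open>rotate1\<close>; by
  finiteness it is mapped onto itself, which gives closure under the inverse rotation as well.
\<close>
lemma rotate1_image_eq:
  assumes "finite W" and "\<And>w. w \<in> W \<Longrightarrow> rotate1 w \<in> W"
  shows "rotate1 ` W = W"
  using assms by (intro endo_inj_surj) (auto intro: inj_on_subset[OF inj_rotate1])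

lemma fin_digraph_overlap_digraph:
  assumes fin: "finite W" and rot: "\<And>w. w \<in> W \<Longrightarrow> rotate1 w \<in> W"
  shows "fin_digraph (overlap_digraph W)"
proof
  fix e assume "e \<in> arcs (overlap_digraph W)"
  then have "e \<in> rotate1 ` W"
    using rotate1_image_eq[OF assms] by (simp add: overlap_digraph_def)
  then show "tail (overlap_digraph W) e \<in> verts (overlap_digraph W)"
    by (auto simp: overlap_digraph_def butlast_rotate1)
qed (use fin in \<open>auto simp: overlap_digraph_def\<close>)

lemma overlap_digraph_balanced:
  assumes fin: "finite W" and rot: "\<And>w. w \<in> W \<Longrightarrow> rotate1 w \<in> W"
  shows "in_degree (overlap_digraph W) v = out_degree (overlap_digraph W) v"
proof -
  let ?in = "{w \<in> W. tl w = v}" and ?out = "{w \<in> W. butlast w = v}"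
  have "rotate1 ` ?in = ?out"
  proof (intro equalityI subsetI)
    fix w assume "w \<in> ?out"
    then have "w \<in> rotate1 ` W" and "butlast w = v"
      using rotate1_image_eq[OF assms] by auto
    then show "w \<in> rotate1 ` ?in" by (auto simp: butlast_rotate1)
  qed (auto simp: rot butlast_rotate1)
  then have "bij_betw rotate1 ?in ?out"
    by (auto simp: bij_betw_def intro: inj_on_subset[OF inj_rotate1])
  then show ?thesis
    by (simp add: in_degree_def out_degree_def in_arcs_def out_arcs_def overlap_digraph_def
        bij_betw_same_card)
qed

lemma overlap_digraph_connected:
  assumes ne: "W \<noteq> {}" and link: "\<And>u v. u \<in> W \<Longrightarrow> v \<in> W \<Longrightarrow> (u, v) \<in> linked W"
  shows "connected (overlap_digraph W)"
proof -
  let ?R = "rtrancl_on (tl ` W) (symcl (arcs_ends (overlap_digraph W)))"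
  have arc: "(tl u, tl v) \<in> symcl (arcs_ends (overlap_digraph W))"
    if "(u, v) \<in> overlap W \<union> (overlap W)\<inverse>" for u v
    using that by (force simp: overlap_def symcl_def arcs_ends_conv overlap_digraph_def)
  have reach: "(tl u, tl v) \<in> ?R" if "u \<in> W" and "(u, v) \<in> linked W" for u v
    using that(2)[unfolded linked_def]
  proof induction
    case base
    show ?case using that(1) by simp
  next
    case (step v w)
    then have "tl w \<in> tl ` W" by (auto simp: overlap_def)
    with step.IH step.hyps show ?case by (blast intro: rtrancl_on_into_rtrancl_on arc)
  qed
  show ?thesis
    unfolding connected_conv using ne link reach by (auto simp: overlap_digraph_def)
qed

lemma (in pre_digraph) cas_nth_Suc:
  "cas u p v \<Longrightarrow> Suc i < length p \<Longrightarrow> head G (p ! i) = tail G (p ! Suc i)"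
proof (induction p arbitrary: u i)
  case (Cons e p)
  then show ?case by (cases i; cases p) auto
qed simp

lemma (in pre_digraph) cas_head_last:
  "cas u p v \<Longrightarrow> p \<noteq> [] \<Longrightarrow> head G (last p) = v"
  by (induction p arbitrary: u) auto

lemma (in pre_digraph) closed_cas_nth_Suc_mod:
  assumes "cas u p u" and "i < length p"
  shows "head G (p ! i) = tail G (p ! (Suc i mod length p))"
proof (cases "Suc i < length p")
  case True
  then show ?thesis using cas_nth_Suc[OF assms(1)] by simp
next
  case False
  then have "Suc i = length p" using assms(2) by simp
  moreover from this have "p ! i = last p"
    by (metis diff_Suc_1 last_conv_nth list.size(3) nat.distinct(1))
  moreover have "tail G (p ! 0) = u" using assms by (cases p) auto
  ultimately show ?thesis using cas_head_last[OF assms(1)] assms(2) by force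
qed

text \<open>
  The letter \<open>j\<close> of a word in the closed sequence \<open>p\<close> is the first letter of the word \<open>j\<close> places
  further on, because each step moves every letter of the overlap one place to the left. Counting
  places modulo the length of \<open>p\<close> covers windows that wrap around, even several times.
\<close>
lemma cyclic_window_map_hd:
  assumes len: "\<And>w. w \<in> set p \<Longrightarrow> length w = n"
    and step: "\<And>i. i < length p \<Longrightarrow> tl (p ! i) = butlast (p ! (Suc i mod length p))"
    and i: "i < length p"
  shows "cyclic_window n (map hd p) i = p ! i"
proof -
  have letter: "p ! i ! j = hd (p ! ((i + j) mod length p))" if "i < length p" and "j < n" for i j
    using that
  proof (induction j arbitrary: i)
    case 0
    then have "p ! i \<noteq> []" using len[of "p ! i"] by auto
    with 0 show ?case by (simp add: hd_conv_nth)
  next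
    case (Suc j)
    let ?i = "Suc i mod length p"
    have i': "?i < length p" using Suc.prems by (intro mod_less_divisor) auto
    have "p ! i ! Suc j = tl (p ! i) ! j"
      using Suc.prems len[of "p ! i"] by (simp add: nth_tl)
    also have "\<dots> = butlast (p ! ?i) ! j"
      using step Suc.prems by simp
    also have "\<dots> = p ! ?i ! j"
      using Suc.prems i' len[of "p ! ?i"] by (simp add: nth_butlast)
    also have "\<dots> = hd (p ! ((?i + j) mod length p))"
      using Suc i' by simp
    finally show ?case by (simp add: mod_add_left_eq)
  qed
  have "p \<noteq> []" using i by auto
  then show ?thesis
    using i len[of "p ! i"] letter[OF i]
    by (intro nth_equalityI) (simp_all add: cyclic_window_def)
qed

theorem universal_cycle_if_rotation_closed:
  assumes \<Sigma>: "finite \<Sigma>" and n: "n \<ge> 1"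
    and words: "\<And>w. w \<in> W \<Longrightarrow> length w = n \<and> set w \<subseteq> \<Sigma>"
    and rot: "\<And>w. w \<in> W \<Longrightarrow> rotate1 w \<in> W"
    and link: "\<And>u v. u \<in> W \<Longrightarrow> v \<in> W \<Longrightarrow> (u, v) \<in> linked W"
  shows "\<exists>c. universal_cycle \<Sigma> n W c"
proof (cases "W = {}")
  case True
  then show ?thesis using \<Sigma> by (intro exI[of _ "[]"]) (simp add: universal_cycle_def)
next
  case False
  have "W \<subseteq> {w. set w \<subseteq> \<Sigma> \<and> length w = n}" using words by blast
  then have fin: "finite W"
    using finite_lists_length_eq[OF \<Sigma>] finite_subset by blast
  interpret fin_digraph "overlap_digraph W"
    using fin rot by (rule fin_digraph_overlap_digraph)
  obtain u p where "euler_trail u p u"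
    using closed_euler1[OF overlap_digraph_connected[OF False link]
        overlap_digraph_balanced[OF fin rot]] by blast
  then have cas: "cas u p u" and dist: "distinct p" and set_p: "set p = W"
    unfolding euler_trail_def trail_def awalk_def
    by (simp_all add: arcs_overlap_digraph)
  have step: "tl (p ! i) = butlast (p ! (Suc i mod length p))" if "i < length p" for i
    using closed_cas_nth_Suc_mod[OF cas that] by (simp add: overlap_digraph_def)
  have window: "cyclic_window n (map hd p) i = p ! i" if "i < length p" for i
    using words set_p step that by (intro cyclic_window_map_hd) auto
  have "hd w \<in> \<Sigma>" if "w \<in> W" for w
    using words[OF that] n by (cases w) auto
  then have "set (map hd p) \<subseteq> \<Sigma>" using set_p by auto
  moreover have "\<exists>!i. i < length (map hd p) \<and> cyclic_window n (map hd p) i = w"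
    if "w \<in> W" for w
    using that set_p dist window
    by (metis in_set_conv_nth length_map nth_eq_iff_index_eq)
  moreover have "length (map hd p) = card W"
    using dist set_p distinct_card by fastforce
  ultimately have "universal_cycle \<Sigma> n W (map hd p)"
    unfolding universal_cycle_def using \<Sigma> fin words by blast
  then show ?thesis by blast
qed

section \<open>Rotation-closed sets of words\<close>

lemma rotate_in_rotation_closed:
  assumes "\<And>w. w \<in> W \<Longrightarrow> rotate1 w \<in> W" and "w \<in> W"
  shows "rotate k w \<in> W"
  using assms by (induction k) auto

lemma linked_rotate:
  assumes rot: "\<And>w. w \<in> W \<Longrightarrow> rotate1 w \<in> W" and w: "w \<in> W"
  shows "(w, rotate k w) \<in> linked W"
proof (induction k)
  case 0
  show ?case by (simp add: linked_refl)
next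
  case (Suc k)
  have "(rotate k w, rotate (Suc k) w) \<in> overlap W"
    using rotate_in_rotation_closed[OF assms] rot by (simp add: overlap_def butlast_rotate1)
  with Suc show ?case by (blast intro: linked_trans linked_overlap)
qed

text \<open>
  Once the letter to be changed is in front, the shift that drops it may append any other letter
  instead of it; the result is a rotation of the changed word.
\<close>
lemma linked_list_update:
  assumes rot: "\<And>w. w \<in> W \<Longrightarrow> rotate1 w \<in> W" and w: "w \<in> W" and w': "w[i := x] \<in> W"
  shows "(w, w[i := x]) \<in> linked W"
proof (cases "i < length w")
  case True
  let ?t = "drop (Suc i) w @ take i w"
  have "rotate i w = w ! i # ?t"
    using True by (simp add: rotate_drop_take Cons_nth_drop_Suc)
  moreover have "rotate i (w[i := x]) = x # ?t"
    using True
    by (simp add: rotate_drop_take Cons_nth_drop_Suc[symmetric, of i "w[i := x]"])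
  ultimately have "tl (rotate i w) = butlast (rotate (Suc i) (w[i := x]))"
    by (simp only: rotate_Suc butlast_rotate1 list.sel)
  then have "(rotate i w, rotate (Suc i) (w[i := x])) \<in> overlap W"
    using rotate_in_rotation_closed[OF rot] w w' by (simp add: overlap_def del: rotate_Suc)
  then show ?thesis
    using linked_rotate[OF rot] w w' by (meson linked_overlap linked_sym linked_trans)
next
  case False
  then show ?thesis by (simp add: linked_refl list_update_beyond)
qed

section \<open>Words containing two given letters\<close>

definition words_with :: "'a \<Rightarrow> 'a \<Rightarrow> 'a set \<Rightarrow> nat \<Rightarrow> 'a list set" where
  "words_with a b \<Sigma> n = {w. length w = n \<and> set w \<subseteq> \<Sigma> \<and> a \<in> set w \<and> b \<in> set w}"

lemma rotate1_words_with: "w \<in> words_with a b \<Sigma> n \<Longrightarrow> rotate1 w \<in> words_with a b \<Sigma> n"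
  by (simp add: words_with_def)

text \<open>
  The prefix \<open>p\<close> already contains both letters, so the rest can be changed letter by letter, with
  all intermediate words in the set.
\<close>
lemma linked_append_words_with:
  assumes "length t = length t'" and "p @ t \<in> words_with a b \<Sigma> n" and "p @ t' \<in> words_with a b \<Sigma> n"
    and "a \<in> set p" and "b \<in> set p"
  shows "(p @ t, p @ t') \<in> linked (words_with a b \<Sigma> n)"
  using assms
proof (induction t t' arbitrary: p rule: list_induct2)
  case Nil
  show ?case by (simp add: linked_refl)
next
  case (Cons x t y t')
  have upd: "(p @ x # t)[length p := y] = (p @ [y]) @ t" by simp
  have mem: "(p @ [y]) @ t \<in> words_with a b \<Sigma> n"
    using Cons.prems Cons.hyps by (auto simp: words_with_def)
  have "(p @ x # t, (p @ [y]) @ t) \<in> linked (words_with a b \<Sigma> n)"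
    using linked_list_update[of "words_with a b \<Sigma> n" "p @ x # t" "length p" y]
      rotate1_words_with Cons.prems(1) mem upd by metis
  moreover have "((p @ [y]) @ t, (p @ [y]) @ t') \<in> linked (words_with a b \<Sigma> n)"
    using Cons.prems mem by (intro Cons.IH) auto
  ultimately show ?case using linked_trans by fastforce
qed

text \<open>
  Rotate an \<open>a\<close> to the front; a second letter exists because \<open>b\<close> occurs as well. Overwriting it
  by \<open>b\<close> keeps the word in the set, wherever the original \<open>b\<close> was.
\<close>
lemma linked_to_prefix:
  assumes "a \<noteq> b" and w: "w \<in> words_with a b \<Sigma> n"
  obtains t where "a # b # t \<in> words_with a b \<Sigma> n" "(w, a # b # t) \<in> linked (words_with a b \<Sigma> n)"
proof -
  let ?W = "words_with a b \<Sigma> n"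
  have "a \<in> set w" using w by (simp add: words_with_def)
  then obtain k where k: "k < length w" "w ! k = a" by (auto simp: in_set_conv_nth)
  then obtain s where s: "rotate k w = a # s"
    by (simp add: rotate_drop_take Cons_nth_drop_Suc[symmetric])
  have as: "a # s \<in> ?W"
    using rotate_in_rotation_closed[of ?W, OF rotate1_words_with w, of k] s by simp
  then obtain x t where t: "s = x # t"
    using \<open>a \<noteq> b\<close> by (cases s) (auto simp: words_with_def)
  have mem: "a # b # t \<in> ?W"
    using as w t by (auto simp: words_with_def)
  have "(a # s, a # b # t) \<in> linked ?W"
    using linked_list_update[of ?W "a # s" 1 b] rotate1_words_with as mem t by force
  moreover have "(w, a # s) \<in> linked ?W"
    using linked_rotate[of ?W w k] rotate1_words_with w s by metis
  ultimately show ?thesis using that mem linked_trans by blast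
qed

lemma linked_words_with:
  assumes "a \<noteq> b" and u: "u \<in> words_with a b \<Sigma> n" and v: "v \<in> words_with a b \<Sigma> n"
  shows "(u, v) \<in> linked (words_with a b \<Sigma> n)"
proof -
  obtain s where s: "a # b # s \<in> words_with a b \<Sigma> n" "(u, a # b # s) \<in> linked (words_with a b \<Sigma> n)"
    using linked_to_prefix[OF \<open>a \<noteq> b\<close> u] .
  obtain t where t: "a # b # t \<in> words_with a b \<Sigma> n" "(v, a # b # t) \<in> linked (words_with a b \<Sigma> n)"
    using linked_to_prefix[OF \<open>a \<noteq> b\<close> v] .
  have "length s = length t" using s(1) t(1) by (simp add: words_with_def)
  then have "(a # b # s, a # b # t) \<in> linked (words_with a b \<Sigma> n)"
    using linked_append_words_with[of s t "[a, b]" a b \<Sigma> n] s(1) t(1) by simp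
  then show ?thesis using s(2) t(2) by (blast intro: linked_trans linked_sym)
qed

theorem universal_cycle_words_with:
  assumes "finite \<Sigma>" and "n \<ge> 1" and "a \<noteq> b"
  shows "\<exists>c. universal_cycle \<Sigma> n (words_with a b \<Sigma> n) c"
  using assms
  by (intro universal_cycle_if_rotation_closed rotate1_words_with linked_words_with)
     (auto simp: words_with_def)

section \<open>Encodings of Sperner pairs\<close>

lemma length_encoding: "length (indicator_string n A \<odot> indicator_string n B) = n"
  by (simp add: string_odot_def indicator_string_def)

lemma nth_encoding:
  assumes "i < n"
  shows "(indicator_string n A \<odot> indicator_string n B) ! i =
    2 * (if Suc i \<in> A then 1 else 0) + (if Suc i \<in> B then 1 else 0)"
  using assms by (simp add: string_odot_def indicator_string_def del: upt_Suc)

lemma letter_in_encoding_iff: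
  "x \<in> set (indicator_string n A \<odot> indicator_string n B) \<longleftrightarrow>
    (\<exists>i\<in>{1..n}. x = 2 * (if i \<in> A then 1 else 0) + (if i \<in> B then 1 else 0))"
proof -
  have "x \<in> set (indicator_string n A \<odot> indicator_string n B) \<longleftrightarrow>
      (\<exists>i\<in>{..<n}. x = 2 * (if Suc i \<in> A then 1 else 0) + (if Suc i \<in> B then 1 else 0))"
    by (auto simp: in_set_conv_nth length_encoding nth_encoding)
  also have "\<dots> \<longleftrightarrow> (\<exists>i\<in>Suc ` {..<n}. x = 2 * (if i \<in> A then 1 else 0) + (if i \<in> B then 1 else 0))"
    by blast
  finally show ?thesis by (simp only: image_Suc_lessThan)
qed

lemma sperner_pair_iff_letters:
  assumes "A \<subseteq> {1..n}" and "B \<subseteq> {1..n}"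
  shows "sperner_pair n (A, B) \<longleftrightarrow>
    1 \<in> set (indicator_string n A \<odot> indicator_string n B) \<and>
    2 \<in> set (indicator_string n A \<odot> indicator_string n B)"
proof -
  have "1 \<in> set (indicator_string n A \<odot> indicator_string n B) \<longleftrightarrow> \<not> B \<subseteq> A"
    using assms by (auto simp: letter_in_encoding_iff split: if_splits)
  moreover have "2 \<in> set (indicator_string n A \<odot> indicator_string n B) \<longleftrightarrow> \<not> A \<subseteq> B"
    using assms by (auto simp: letter_in_encoding_iff split: if_splits)
  ultimately show ?thesis using assms by (auto simp: sperner_pair_def)
qed

text \<open>Reading the letters in binary gives the pair of sets back.\<close>
lemma encoding_surj:
  assumes "set w \<subseteq> {0, 1, 2, 3}" and n: "length w = n"
  obtains A B where "A \<subseteq> {1..n}" "B \<subseteq> {1..n}" "w = indicator_string n A \<odot> indicator_string n B"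
proof
  let ?A = "{i \<in> {1..n}. w ! (i - 1) \<in> {2, 3}}" and ?B = "{i \<in> {1..n}. w ! (i - 1) \<in> {1, 3}}"
  show "w = indicator_string n ?A \<odot> indicator_string n ?B"
  proof (rule nth_equalityI)
    fix i assume "i < length w"
    then have "w ! i \<in> {0, 1, 2, 3}" and "i < n" using assms nth_mem by blast+
    then show "w ! i = (indicator_string n ?A \<odot> indicator_string n ?B) ! i"
      by (auto simp: nth_encoding)
  qed (simp add: length_encoding n)
qed auto

lemma sperner_encodings_eq: "sperner_encodings n = words_with 1 2 {0, 1, 2, 3} n"
proof (intro equalityI subsetI)
  fix w assume "w \<in> sperner_encodings n"
  then obtain A B where w: "w = indicator_string n A \<odot> indicator_string n B"
    and P: "sperner_pair n (A, B)"
    by (auto simp: sperner_encodings_def)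
  have "1 \<in> set w \<and> 2 \<in> set w"
    using P sperner_pair_iff_letters[of A n B] w by (simp add: sperner_pair_def)
  moreover have "set w \<subseteq> {0, 1, 2, 3}" by (auto simp: w letter_in_encoding_iff split: if_splits)
  ultimately show "w \<in> words_with 1 2 {0, 1, 2, 3} n"
    by (simp add: words_with_def w length_encoding)
next
  fix w :: "nat list" assume w: "w \<in> words_with 1 2 {0, 1, 2, 3} n"
  then obtain A B where AB: "A \<subseteq> {1..n}" "B \<subseteq> {1..n}"
    and eq: "w = indicator_string n A \<odot> indicator_string n B"
    using encoding_surj[of w n] by (auto simp: words_with_def)
  have "sperner_pair n (A, B)"
    using w sperner_pair_iff_letters[OF AB] by (simp add: words_with_def eq)
  with eq show "w \<in> sperner_encodings n" by (auto simp: sperner_encodings_def)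
qed

theorem corollary13:
  fixes n :: nat
  assumes "n \<ge> 1"
  shows "\<exists>c. universal_cycle {0, 1, 2, 3} n (sperner_encodings n) c"
  unfolding sperner_encodings_eq using assms by (intro universal_cycle_words_with) auto

end
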